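(* Let $n$ be a positive integer. The minimum distance and the stopping distance of the binary code $\mathcal{C}(n,2)$ (with respect to the parity-check matrix $H(n,2)$) are both $2^{\frac{n(n+1)}{2}}$.
   Context: $\mathbb{S}_n(\mathbb{F}_2)$ denotes the set of $n\times n$ symmetric matrices over $\mathbb{F}_2$ (its elements are called points). Two points $S,S'$ are adjacent if $\operatorname{rank}(S-S')=1$. A line is a maximal set of rank $1$: a subset $\mathcal{M}\subseteq\mathbb{S}_n(\mathbb{F}_2)$ such that any two distinct points of $\mathcal{M}$ are adjacent and no point outside $\mathcal{M}$ is adjacent to every point of $\mathcal{M}$. $H(n,2)$ is the binary matrix with rows indexed by the lines and columns indexed by the points, whose (line, point) entry is $1$ iff the point belongs to the line. $\mathcal{C}(n,2)=\{c\in\mathbb{F}_2^{\text{points}}: H(n,2)c=0\}$. A stopping set is a set $T$ of coordinate positions such that no row of $H(n,2)$ has exactly one $1$ among the positions in $T$; the stopping distance is the minimum size of a nonempty stopping set. *)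

theory Defs
  imports "HOL-Library.Z2" "HOL-Library.FuncSet" "Jordan_Normal_Form.DL_Rank"
begin

definition sym_mats :: "nat \<Rightarrow> bit mat set" where
  "sym_mats n = {S \<in> carrier_mat n n. transpose_mat S = S}"

definition adjacent :: "nat \<Rightarrow> bit mat \<Rightarrow> bit mat \<Rightarrow> bool" where
  "adjacent n S T \<longleftrightarrow> vec_space.rank n (S - T) = 1"

definition is_line :: "nat \<Rightarrow> bit mat set \<Rightarrow> bool" where
  "is_line n M \<longleftrightarrow>
     M \<subseteq> sym_mats n \<and>
     (\<forall>S\<in>M. \<forall>T\<in>M. S \<noteq> T \<longrightarrow> adjacent n S T) \<and>
     \<not> (\<exists>S \<in> sym_mats n - M. \<forall>T\<in>M. adjacent n S T)"

definition sym_lines :: "nat \<Rightarrow> bit mat set set" where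
  "sym_lines n = {M. is_line n M}"

(* A binary matrix with row index set R and column index set P is a function
   'r \<Rightarrow> 'p \<Rightarrow> bit, of which only the values on R \<times> P matter.
   A word is an element of P \<rightarrow>\<^sub>E UNIV; extensionality makes words correspond
   bijectively to the vectors indexed by P. *)

definition parity_check_code ::
  "'r set \<Rightarrow> 'p set \<Rightarrow> ('r \<Rightarrow> 'p \<Rightarrow> bit) \<Rightarrow> ('p \<Rightarrow> bit) set" where
  "parity_check_code R P H = {c \<in> P \<rightarrow>\<^sub>E UNIV. \<forall>r\<in>R. (\<Sum>p\<in>P. H r p * c p) = 0}"

definition hamming_dist :: "'p set \<Rightarrow> ('p \<Rightarrow> bit) \<Rightarrow> ('p \<Rightarrow> bit) \<Rightarrow> nat" where
  "hamming_dist P c d = card {p \<in> P. c p \<noteq> d p}"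

(* Infimum in nat: the minimum of a nonempty set, and 0 for the empty set. Any positive
   value of the following two quantities is therefore attained. *)

definition min_distance :: "'p set \<Rightarrow> ('p \<Rightarrow> bit) set \<Rightarrow> nat" where
  "min_distance P C = Inf {hamming_dist P c d | c d. c \<in> C \<and> d \<in> C \<and> c \<noteq> d}"

definition stopping_set ::
  "'r set \<Rightarrow> 'p set \<Rightarrow> ('r \<Rightarrow> 'p \<Rightarrow> bit) \<Rightarrow> 'p set \<Rightarrow> bool" where
  "stopping_set R P H T \<longleftrightarrow> T \<subseteq> P \<and> (\<forall>r\<in>R. card {p \<in> T. H r p = 1} \<noteq> 1)"

definition stopping_distance ::
  "'r set \<Rightarrow> 'p set \<Rightarrow> ('r \<Rightarrow> 'p \<Rightarrow> bit) \<Rightarrow> nat" where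
  "stopping_distance R P H = Inf {card T | T. stopping_set R P H T \<and> T \<noteq> {}}"

definition H_mat :: "bit mat set \<Rightarrow> bit mat \<Rightarrow> bit" where
  "H_mat M S = (if S \<in> M then 1 else 0)"

definition sym_code :: "nat \<Rightarrow> (bit mat \<Rightarrow> bit) set" where
  "sym_code n = parity_check_code (sym_lines n) (sym_mats n) H_mat"

(* Needed for the sums and cardinalities over the points to be meaningful. *)
lemma finite_sym_mats: "finite (sym_mats n)"
proof (rule finite_subset)
  have bit: "finite (UNIV :: bit set)"
    by (rule finite_subset[of _ "{0, 1}"]) (auto intro: bit.exhaust)
  show "sym_mats n \<subseteq>
      (\<lambda>f. mat n n f) ` (({..<n} \<times> {..<n}) \<rightarrow>\<^sub>E (UNIV :: bit set))"
  proof
    fix S assume "S \<in> sym_mats n"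
    then have "S \<in> carrier_mat n n" by (simp add: sym_mats_def)
    then have "S = mat n n (restrict (\<lambda>ij. S $$ ij) ({..<n} \<times> {..<n}))"
      by (intro eq_matI) auto
    moreover have "restrict (\<lambda>ij. S $$ ij) ({..<n} \<times> {..<n})
        \<in> ({..<n} \<times> {..<n}) \<rightarrow>\<^sub>E (UNIV :: bit set)"
      by simp
    ultimately show "S \<in> (\<lambda>f. mat n n f) ` (({..<n} \<times> {..<n}) \<rightarrow>\<^sub>E (UNIV :: bit set))"
      by blast
  qed
  show "finite ((\<lambda>f. mat n n f) ` (({..<n} \<times> {..<n}) \<rightarrow>\<^sub>E (UNIV :: bit set)))"
    using bit by (intro finite_imageI finite_PiE) auto
qed

end

theory Submission
  imports Defs
begin

text \<open>A symmetric rank one matrix over the two-element field is determined by its diagonal, being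
  \<open>x x\<^sup>T\<close> for the diagonal \<open>x\<close>; and \<open>x x\<^sup>T + y y\<^sup>T\<close> with \<open>x \<noteq> y\<close> nonzero has rank two. Hence
  adjacency is triangle-free and the lines are exactly the pairs of adjacent points, i.e. the edges
  of the adjacency graph. A codeword is constant along edges, and a stopping set contains both or
  none of the ends of an edge. The graph is connected because
  \<open>E\<^sub>i\<^sub>j + E\<^sub>j\<^sub>i = (e\<^sub>i + e\<^sub>j) (e\<^sub>i + e\<^sub>j)\<^sup>T + e\<^sub>i e\<^sub>i\<^sup>T + e\<^sub>j e\<^sub>j\<^sup>T\<close>, so the code is the repetition code and the
  only nonempty stopping set is the set of all points.\<close>

section \<open>Bit arithmetic and symmetric matrices\<close>

text \<open>These simp rules would turn sums and products of bits into \<open>XOR\<close> and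
  \<open>AND\<close>, hiding the field structure.\<close>

declare add_bit_eq_xor [simp del] mult_bit_eq_and [simp del]

lemma bit_neq_0_iff: "(x :: bit) \<noteq> 0 \<longleftrightarrow> x = 1"
  by (cases x) auto

lemma bit_eqI_1: "((x :: bit) = 1 \<longleftrightarrow> y = 1) \<Longrightarrow> x = y"
  by (cases x; cases y) auto

lemma bit_mult_eq_1_iff: "(x :: bit) * y = 1 \<longleftrightarrow> x = 1 \<and> y = 1"
  by (cases x; cases y) auto

lemma sym_mats_sym:
  assumes "S \<in> sym_mats n" "i < n" "j < n"
  shows "S $$ (i, j) = S $$ (j, i)"
proof -
  have "S \<in> carrier_mat n n" "transpose_mat S = S" using assms by (auto simp: sym_mats_def)
  then show ?thesis using assms by (metis carrier_matD index_transpose_mat(1))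
qed

lemma sym_matsI:
  assumes "S \<in> carrier_mat n n" "\<And>i j. i < n \<Longrightarrow> j < n \<Longrightarrow> S $$ (i, j) = S $$ (j, i)"
  shows "S \<in> sym_mats n"
  unfolding sym_mats_def using assms by (auto intro!: eq_matI)

lemma sym_mats_carrier: "S \<in> sym_mats n \<Longrightarrow> S \<in> carrier_mat n n"
  by (simp add: sym_mats_def)

lemma add_sym_mats:
  assumes "S \<in> sym_mats n" "T \<in> sym_mats n"
  shows "S + T \<in> sym_mats n"
  using sym_mats_carrier[OF assms(1)] sym_mats_carrier[OF assms(2)]
    sym_mats_sym[OF assms(1)] sym_mats_sym[OF assms(2)]
  by (intro sym_matsI) auto

lemma diff_sym_mats:
  assumes "S \<in> sym_mats n" "T \<in> sym_mats n"
  shows "S - T \<in> sym_mats n"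
  using sym_mats_carrier[OF assms(1)] sym_mats_carrier[OF assms(2)]
    sym_mats_sym[OF assms(1)] sym_mats_sym[OF assms(2)]
  by (intro sym_matsI) auto

section \<open>Matrices of rank one\<close>

definition outer :: "nat \<Rightarrow> (nat \<Rightarrow> bit) \<Rightarrow> bit mat" where
  "outer n x = mat n n (\<lambda>(i, j). x i * x j)"

lemma outer_sym_mats: "outer n x \<in> sym_mats n"
  by (rule sym_matsI) (auto simp: outer_def mult.commute)

text \<open>The only nonzero coefficient is 1, so a dependence among at most two nonzero vectors
  makes one of them zero or the two equal.\<close>

lemma bit_lin_indpt:
  fixes U :: "bit vec set"
  assumes "finite U" "card U \<le> 2" "U \<subseteq> carrier_vec n" "0\<^sub>v n \<notin> U"
  shows "\<not> module.lin_dep class_ring (module_vec TYPE(bit) n) U"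
proof
  interpret vec_space "TYPE(bit)" n .
  assume "lin_dep U"
  then obtain a w where a: "lincomb a U = 0\<^sub>v n" "w \<in> U" "a w \<noteq> 0"
    using finite_lin_dep[OF assms(1)] assms(3) by (metis)
  have s: "(\<Sum>u\<in>U. a u * u $ i) = 0" if "i < n" for i
    using lincomb_index[OF that assms(3), of a] a(1) that by simp
  have aw: "a w = 1" using a(3) by (simp add: bit_neq_0_iff)
  have w: "w \<in> carrier_vec n" "w \<noteq> 0\<^sub>v n" using assms a(2) by auto
  \<comment> \<open>The vector \<open>w\<close> is split off because its coefficient is 1; at most
    one other vector remains.\<close>
  have r: "w $ i + (\<Sum>u\<in>U - {w}. a u * u $ i) = 0" if "i < n" for i
    using s[OF that] assms(1) a(2) aw by (simp add: sum.remove[of U w])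
  have "card (U - {w}) \<le> 1" using assms(1,2) a(2) by simp
  then consider "U - {w} = {}" | v where "U - {w} = {v}"
    using assms(1) by (metis card_1_singletonE card_0_eq finite_Diff le_antisym less_one linorder_not_le)
  then show False
  proof cases
    case 1
    then show False using r w by (metis add.right_neutral carrier_vecD eq_vecI index_zero_vec sum.empty)
  next
    case 2
    then have v: "v \<in> carrier_vec n" "v \<noteq> w" using assms(3) by auto
    have e: "w $ i + a v * v $ i = 0" if "i < n" for i using r[OF that] 2 by simp
    show False
    proof (cases "a v = 0")
      case True
      have "w = 0\<^sub>v n"
        using w(1) e True by (intro eq_vecI) auto
      with w(2) show False ..
    next
      case False
      have eq: "w $ i = v $ i" if "i < n" for i
        using e[OF that] False by (cases "w $ i"; cases "v $ i") (auto simp: bit_neq_0_iff)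
      have "w = v"
        using w(1) v(1) eq by (intro eq_vecI) auto
      with v(2) show False by simp
    qed
  qed
qed

text \<open>With \<open>bit_lin_indpt\<close>, one nonzero column gives rank at least 1, and two
  distinct nonzero columns give rank at least 2.\<close>

lemma bit_rank_ge:
  fixes A :: "bit mat"
  assumes "A \<in> carrier_mat n m" "U \<subseteq> set (cols A)" "card U \<le> 2" "0\<^sub>v n \<notin> U"
  shows "card U \<le> vec_space.rank n A"
proof -
  interpret vec_space "TYPE(bit)" n .
  have "finite U" using assms(2) finite_subset by blast
  moreover have "U \<subseteq> carrier_vec n" using assms(1,2) cols_dim by blast
  ultimately show ?thesis
    using rank_ge_card_indpt[OF assms(1,2)] bit_lin_indpt[of U n] assms(3,4) by blast
qed

lemma bit_rank_outer:
  assumes "i < n" "x i = 1"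
  shows "vec_space.rank n (outer n x) = 1"
proof -
  interpret vec_space "TYPE(bit)" n .
  have c: "outer n x \<in> carrier_mat n n" by (simp add: outer_def)
  have "rank (outer n x) \<le> 1"
    using rank_le_1_product_entries[OF c, of x x] by (simp add: outer_def)
  moreover have "col (outer n x) i \<in> set (cols (outer n x))"
    using assms(1) by (auto simp: cols_def outer_def)
  moreover have "col (outer n x) i $ i \<noteq> 0\<^sub>v n $ i"
    using assms by (simp add: outer_def)
  ultimately show ?thesis
    using bit_rank_ge[OF c, of "{col (outer n x) i}"] by fastforce
qed

text \<open>The two entries equal to 1 witness that columns \<open>j\<close> and \<open>j'\<close>
  are nonzero; if they differed in row \<open>k\<close>, the rank would be at least 2.\<close>

lemma bit_rank_1_cols:
  fixes A :: "bit mat"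
  assumes A: "A \<in> carrier_mat n m" "vec_space.rank n A = 1"
    and "i < n" "j < m" "A $$ (i, j) = 1" "i' < n" "j' < m" "A $$ (i', j') = 1" "k < n"
  shows "A $$ (k, j) = A $$ (k, j')"
proof (rule ccontr)
  assume ne: "A $$ (k, j) \<noteq> A $$ (k, j')"
  let ?U = "{col A j, col A j'}"
  have "col A j \<noteq> col A j'"
    using ne assms by (metis carrier_matD index_col)
  then have "card ?U = 2" by simp
  moreover have "?U \<subseteq> set (cols A)" using assms by (auto simp: cols_def)
  moreover have "0\<^sub>v n \<notin> ?U"
    using assms by (metis carrier_matD index_col index_zero_vec(1) insertE singletonD zero_neq_one)
  ultimately show False using bit_rank_ge[OF A(1), of ?U] A(2) by simp
qed

text \<open>All nonzero columns agree. If the entry at (\<open>i\<close>, \<open>j\<close>) is 1,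
  symmetry makes columns \<open>i\<close> and \<open>j\<close> nonzero, and comparing them in rows
  \<open>i\<close> and \<open>j\<close> yields both diagonal entries. Conversely, two diagonal ones
  make both columns nonzero, and row \<open>i\<close> gives the mixed entry.\<close>

lemma sym_rank_1_entries:
  assumes "A \<in> sym_mats n" "vec_space.rank n A = 1" "i < n" "j < n"
  shows "A $$ (i, j) = A $$ (i, i) * A $$ (j, j)"
proof (rule bit_eqI_1)
  note cols = bit_rank_1_cols[OF sym_mats_carrier[OF assms(1)] assms(2)]
  have s: "A $$ (i, j) = A $$ (j, i)" using sym_mats_sym[OF assms(1,3,4)] .
  have "A $$ (i, i) = 1 \<and> A $$ (j, j) = 1" if "A $$ (i, j) = 1"
    using cols[of i j j i i] cols[of i j j i j] that s assms(3,4) by simp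
  moreover have "A $$ (i, j) = 1" if "A $$ (i, i) = 1" "A $$ (j, j) = 1"
    using cols[of i i j j i] that assms(3,4) by simp
  ultimately show "A $$ (i, j) = 1 \<longleftrightarrow> A $$ (i, i) * A $$ (j, j) = 1"
    unfolding bit_mult_eq_1_iff by blast
qed

lemma sym_rank_1_diag:
  assumes "A \<in> sym_mats n" "vec_space.rank n A = 1"
  shows "\<exists>i<n. A $$ (i, i) = 1"
proof (rule ccontr)
  interpret vec_space "TYPE(bit)" n .
  assume diag: "\<not> (\<exists>i<n. A $$ (i, i) = 1)"
  have "A $$ (i, j) = 0" if "i < n" "j < n" for i j
    using sym_rank_1_entries[OF assms that] diag that bit_mult_eq_1_iff bit_neq_0_iff by metis
  then have "A = 0\<^sub>m n n"
    using sym_mats_carrier[OF assms(1)] by (intro eq_matI) auto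
  then show False using assms(2) by (simp add: rank_0I)
qed

section \<open>Adjacency and the shape of lines\<close>

lemma not_adjacent_self: "S \<in> sym_mats n \<Longrightarrow> \<not> adjacent n S S"
proof -
  interpret vec_space "TYPE(bit)" n .
  assume "S \<in> sym_mats n"
  then have "S - S = 0\<^sub>m n n" by (auto simp: sym_mats_def intro!: eq_matI)
  then show ?thesis by (simp add: adjacent_def rank_0I)
qed

lemma adjacent_sym:
  assumes "S \<in> sym_mats n" "T \<in> sym_mats n"
  shows "adjacent n S T \<longleftrightarrow> adjacent n T S"
proof -
  have "S - T = T - S"
  proof (rule eq_matI)
    fix i j assume "i < dim_row (T - S)" "j < dim_col (T - S)"
    then show "(S - T) $$ (i, j) = (T - S) $$ (i, j)"
      using assms[THEN sym_mats_carrier]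
      by (cases "S $$ (i, j)"; cases "T $$ (i, j)") auto
  qed (use assms[THEN sym_mats_carrier] in auto)
  then show ?thesis by (simp add: adjacent_def)
qed

text \<open>Source of all edges used later. The difference is \<open>outer n x\<close> itself
  because negation is the identity in characteristic two; \<open>x i = 1\<close> makes it
  nonzero.\<close>

lemma adjacent_add_outer:
  assumes "S \<in> sym_mats n" "i < n" "x i = 1"
  shows "adjacent n S (S + outer n x)"
proof -
  have "S - (S + outer n x) = outer n x"
  proof (rule eq_matI)
    fix k l assume "k < dim_row (outer n x)" "l < dim_col (outer n x)"
    then show "(S - (S + outer n x)) $$ (k, l) = outer n x $$ (k, l)"
      using assms sym_mats_carrier[OF assms(1)]
      by (cases "x k"; cases "x l"; cases "S $$ (k, l)") (auto simp: outer_def)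
  qed (use sym_mats_carrier[OF assms(1)] in \<open>auto simp: outer_def\<close>)
  then show ?thesis using bit_rank_outer[of i n x] assms by (simp add: adjacent_def)
qed

text \<open>Expanding modulo 2, the two mixed products must cancel. Applied to diagonal entries of
  two rank one matrices, this says that the 2 by 2 minors of the diagonals vanish.\<close>

lemma bit_outer_sum:
  fixes x x' y y' :: bit
  assumes "(x - y) * (x' - y') = x * x' - y * y'"
  shows "x * y' = y * x'"
  using assms by (cases x; cases x'; cases y; cases y') auto

text \<open>The diagonals of \<open>S - T\<close> and \<open>S - U\<close> are nonzero and
  proportional, hence equal over the two-element field. Then \<open>T - U\<close> has zero diagonal,
  which rank one forbids.\<close>

lemma no_triangle:
  assumes S: "S \<in> sym_mats n" and T: "T \<in> sym_mats n" and U: "U \<in> sym_mats n"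
    and adj: "adjacent n S T" "adjacent n S U" "adjacent n T U"
  shows False
proof -
  let ?A = "S - T" and ?B = "S - U" and ?C = "T - U"
  note cs = S[THEN sym_mats_carrier] T[THEN sym_mats_carrier] U[THEN sym_mats_carrier]
  have sm: "?A \<in> sym_mats n" "?B \<in> sym_mats n" "?C \<in> sym_mats n"
    using S T U by (simp_all add: diff_sym_mats)
  have ent: "?A $$ (i, j) = ?A $$ (i, i) * ?A $$ (j, j)" "?B $$ (i, j) = ?B $$ (i, i) * ?B $$ (j, j)"
    "?C $$ (i, j) = ?C $$ (i, i) * ?C $$ (j, j)" if "i < n" "j < n" for i j
    using sym_rank_1_entries[OF sm(1) _ that] sym_rank_1_entries[OF sm(2) _ that]
      sym_rank_1_entries[OF sm(3) _ that] adj unfolding adjacent_def by blast+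
  have C: "?C $$ (i, j) = ?B $$ (i, j) - ?A $$ (i, j)" if "i < n" "j < n" for i j
    using that cs by simp
  have sw: "?B $$ (i, i) * ?A $$ (j, j) = ?A $$ (i, i) * ?B $$ (j, j)" if "i < n" "j < n" for i j
    using ent(3)[OF that]
    unfolding C[OF that] C[OF that(1) that(1)] C[OF that(2) that(2)] ent(1)[OF that] ent(2)[OF that]
    by (intro bit_outer_sum) (rule sym)
  obtain i where i: "i < n" "?A $$ (i, i) = 1" using sym_rank_1_diag[OF sm(1)] adj by (auto simp: adjacent_def)
  obtain j where j: "j < n" "?B $$ (j, j) = 1" using sym_rank_1_diag[OF sm(2)] adj by (auto simp: adjacent_def)
  obtain k where k: "k < n" "?C $$ (k, k) = 1" using sym_rank_1_diag[OF sm(3)] adj by (auto simp: adjacent_def)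
  \<comment> \<open>Proportionality at \<open>i\<close> and \<open>j\<close> produces a common index
    \<open>i\<close> where both diagonals are 1; at \<open>i\<close> and \<open>k\<close> it then
    gives equality in position \<open>k\<close>.\<close>
  have "?B $$ (i, i) * ?A $$ (j, j) = 1" using sw[OF i(1) j(1)] i(2) j(2) by (metis mult_1_left)
  then have "?B $$ (i, i) = 1" unfolding bit_mult_eq_1_iff ..
  then have "?A $$ (k, k) = ?B $$ (k, k)" using sw[OF i(1) k(1)] i(2) by (metis mult_1_left)
  then show False using C[OF k(1) k(1)] k(2) by (metis diff_self zero_neq_one)
qed

text \<open>A clique has at most two points by \<open>no_triangle\<close>. Maximality excludes
  fewer, since there is a point and every point has a neighbour when \<open>n \<ge> 1\<close>.
  Conversely, a point adjacent to both ends of an edge would close a triangle.\<close>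

lemma is_line_iff:
  assumes "n \<ge> 1"
  shows "is_line n M \<longleftrightarrow>
    (\<exists>S T. M = {S, T} \<and> S \<in> sym_mats n \<and> T \<in> sym_mats n \<and> adjacent n S T)"
proof
  assume M: "is_line n M"
  then have sub: "M \<subseteq> sym_mats n"
    and clique: "\<And>S T. S \<in> M \<Longrightarrow> T \<in> M \<Longrightarrow> S \<noteq> T \<Longrightarrow> adjacent n S T"
    and max: "\<And>U. U \<in> sym_mats n \<Longrightarrow> \<forall>S\<in>M. adjacent n U S \<Longrightarrow> U \<in> M"
    by (auto simp: is_line_def)
  \<comment> \<open>Every point is vacuously adjacent to all of an empty \<open>M\<close>, so
    maximality would put it into \<open>M\<close>.\<close>
  from outer_sym_mats max have "M \<noteq> {}" by blast
  then obtain S where S: "S \<in> M" by blast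
  have "M \<noteq> {S}"
  proof
    assume eq: "M = {S}"
    \<comment> \<open>The all-ones matrix has rank one; its diagonal entry at index 0 exists because
      \<open>n \<ge> 1\<close>.\<close>
    let ?T = "S + outer n (\<lambda>_. 1)"
    have T: "?T \<in> sym_mats n" using S sub by (auto intro: add_sym_mats outer_sym_mats)
    have "adjacent n S ?T" using S sub assms by (intro adjacent_add_outer[of _ _ 0]) auto
    moreover from this have "?T \<in> M" using max[OF T] S sub T adjacent_sym eq by (metis singletonD subsetD)
    ultimately show False using eq S sub not_adjacent_self by (metis singletonD subsetD)
  qed
  then obtain T where T: "T \<in> M" "T \<noteq> S" using S by blast
  have "M = {S, T}" using no_triangle[of S n T] clique S T sub by blast
  then show "\<exists>S T. M = {S, T} \<and> S \<in> sym_mats n \<and> T \<in> sym_mats n \<and> adjacent n S T"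
    using S T sub clique by blast
next
  assume "\<exists>S T. M = {S, T} \<and> S \<in> sym_mats n \<and> T \<in> sym_mats n \<and> adjacent n S T"
  then obtain S T where M: "M = {S, T}" and ST: "S \<in> sym_mats n" "T \<in> sym_mats n" "adjacent n S T"
    by blast
  show "is_line n M"
    unfolding is_line_def M using ST adjacent_sym no_triangle by (auto 0 4)
qed

section \<open>Connectedness of the adjacency graph\<close>

lemma add_outer_elementary:
  assumes S: "S \<in> carrier_mat n n" and "i \<noteq> j"
  shows "S + outer n (\<lambda>k. of_bool (k = i \<or> k = j)) + outer n (\<lambda>k. of_bool (k = i))
    + outer n (\<lambda>k. of_bool (k = j)) = S + mat n n (\<lambda>(k, l). of_bool ({k, l} = {i, j}))"
    (is "?L = ?R")
proof (rule eq_matI)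
  fix k l assume "k < dim_row ?R" "l < dim_col ?R"
  moreover have "of_bool (k = i \<or> k = j) * of_bool (l = i \<or> l = j) + of_bool (k = i) * of_bool (l = i)
      + of_bool (k = j) * of_bool (l = j) = (of_bool ({k, l} = {i, j}) :: bit)"
    using \<open>i \<noteq> j\<close> unfolding doubleton_eq_iff
    by (cases "k = i"; cases "k = j"; cases "l = i"; cases "l = j") simp_all
  ultimately show "?L $$ (k, l) = ?R $$ (k, l)"
    using S by (simp add: outer_def add.assoc)
qed (use S in \<open>auto simp: outer_def\<close>)

text \<open>Connectedness in the form that suits both the support of a codeword and a stopping set.
  Any point is turned into any other by correcting one symmetric pair of entries at a time.\<close>

lemma adjacent_closed_eq_sym_mats:
  assumes sub: "T \<subseteq> sym_mats n" and ne: "T \<noteq> {}"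
    and closed: "\<And>S U. S \<in> T \<Longrightarrow> U \<in> sym_mats n \<Longrightarrow> adjacent n S U \<Longrightarrow> U \<in> T"
  shows "T = sym_mats n"
proof -
  have add_outer: "S + outer n x \<in> T" if "S \<in> T" "i < n" "x i = 1" for S x i
    using that sub by (intro closed[OF that(1)] add_sym_mats outer_sym_mats adjacent_add_outer[of S n i x]) auto
  \<comment> \<open>This flips the entries (\<open>i\<close>, \<open>j\<close>) and
    (\<open>j\<close>, \<open>i\<close>), or the single diagonal entry if \<open>i = j\<close>: one
    edge in the diagonal case, a path of three otherwise.\<close>
  have add_elem: "S + mat n n (\<lambda>(k, l). of_bool ({k, l} = {i, j})) \<in> T"
    if S: "S \<in> T" and ij: "i < n" "j < n" for S i j
  proof (cases "i = j")
    case True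
    have "mat n n (\<lambda>(k, l). of_bool ({k, l} = {i, j})) = outer n (\<lambda>k. of_bool (k = i))"
      using True by (intro eq_matI) (auto simp: outer_def)
    then show ?thesis using add_outer[OF S, of i "\<lambda>k. of_bool (k = i)"] ij(1) by simp
  next
    case False
    have "S \<in> carrier_mat n n" using S sub sym_mats_carrier by blast
    from add_outer_elementary[OF this False] show ?thesis
      using add_outer[OF add_outer[OF add_outer[OF S, of i "\<lambda>k. of_bool (k = i \<or> k = j)"],
            of i "\<lambda>k. of_bool (k = i)"], of j "\<lambda>k. of_bool (k = j)"] ij by simp
  qed
  have "U \<in> T" if U: "U \<in> sym_mats n" and "S \<in> T" for U S
    using \<open>S \<in> T\<close>
  proof (induction "card {(k, l) \<in> {..<n} \<times> {..<n}. S $$ (k, l) \<noteq> U $$ (k, l)}"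
      arbitrary: S rule: less_induct)
    case (less S)
    let ?D = "\<lambda>S. {(k, l) \<in> {..<n} \<times> {..<n}. S $$ (k, l) \<noteq> U $$ (k, l)}"
    have Ss: "S \<in> sym_mats n" using less.prems sub by blast
    note cs = sym_mats_carrier[OF Ss] sym_mats_carrier[OF U]
    show ?case
    proof (cases "?D S = {}")
      case True
      then have "U = S" using cs by (intro eq_matI) auto
      then show ?thesis using less.prems by simp
    next
      case False
      then obtain i j where ij: "i < n" "j < n" "S $$ (i, j) \<noteq> U $$ (i, j)" by blast
      let ?S = "S + mat n n (\<lambda>(k, l). of_bool ({k, l} = {i, j}))"
      have ji: "S $$ (j, i) \<noteq> U $$ (j, i)"
        using ij sym_mats_sym[OF Ss ij(1,2)] sym_mats_sym[OF U ij(1,2)] by simp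
      \<comment> \<open>A wrong bit becomes right when flipped; \<open>ji\<close> covers the
        mirrored position.\<close>
      have in_: "?S $$ (k, l) = U $$ (k, l)" if "{k, l} = {i, j}" for k l
        using that ij ji cs
        by (cases "S $$ (k, l)"; cases "U $$ (k, l)") (auto simp: doubleton_eq_iff)
      have out: "?S $$ (k, l) = S $$ (k, l)" if "{k, l} \<noteq> {i, j}" "k < n" "l < n" for k l
        using that cs by (cases "S $$ (k, l)") auto
      have "?D ?S \<subseteq> ?D S"
      proof safe
        fix k l assume kl: "k < n" "l < n" "?S $$ (k, l) \<noteq> U $$ (k, l)"
          "S $$ (k, l) = U $$ (k, l)"
        then show False using in_[of k l] out[of k l] by (cases "{k, l} = {i, j}") auto
      qed
      moreover have "(i, j) \<in> ?D S" "(i, j) \<notin> ?D ?S" using ij in_[of i j] by auto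
      ultimately have "?D ?S \<subset> ?D S" by blast
      moreover have "finite (?D S)" by (rule finite_subset[of _ "{..<n} \<times> {..<n}"]) auto
      ultimately show ?thesis
        using less.hyps[OF psubset_card_mono add_elem[OF less.prems ij(1,2)]] by blast
    qed
  qed
  with ne sub show ?thesis by blast
qed

section \<open>Counting the points\<close>

lemma card_pairs_le: "card {(i, j). i \<le> j \<and> j < (n :: nat)} = n * (n + 1) div 2"
proof -
  have "{(i, j). i \<le> j \<and> j < n} = prod.swap ` (SIGMA j : {..<n}. {..j})" by auto
  then have "card {(i, j). i \<le> j \<and> j < n} = (\<Sum>j<n. Suc j)"
    by (simp add: card_image)
  also have "\<dots> = n * (n + 1) div 2"
    by (induction n) auto
  finally show ?thesis .
qed

text \<open>A symmetric matrix corresponds to an arbitrary filling of its upper triangle, diagonal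
  included.\<close>

lemma card_sym_mats: "card (sym_mats n) = 2 ^ (n * (n + 1) div 2)"
proof -
  let ?P = "{(i, j). i \<le> j \<and> j < n}"
  have fin: "finite ?P" by (rule finite_subset[of _ "{..<n} \<times> {..<n}"]) auto
  have "bij_betw (\<lambda>S. restrict (\<lambda>p. S $$ p) ?P) (sym_mats n) (?P \<rightarrow>\<^sub>E (UNIV :: bit set))"
  \<comment> \<open>The inverse reflects each position into the upper triangle with
    \<open>min\<close> and \<open>max\<close>.\<close>
  proof (rule bij_betw_byWitness[where f' = "\<lambda>f. mat n n (\<lambda>(i, j). f (min i j, max i j))"])
    show "\<forall>S\<in>sym_mats n. mat n n (\<lambda>(i, j). restrict (\<lambda>p. S $$ p) ?P (min i j, max i j)) = S"
    proof
      fix S assume S: "S \<in> sym_mats n"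
      show "mat n n (\<lambda>(i, j). restrict (\<lambda>p. S $$ p) ?P (min i j, max i j)) = S"
        using sym_mats_carrier[OF S] sym_mats_sym[OF S]
        by (intro eq_matI) (auto simp: min_def max_def)
    qed
    show "\<forall>f\<in>?P \<rightarrow>\<^sub>E UNIV. restrict (\<lambda>p. mat n n (\<lambda>(i, j). f (min i j, max i j)) $$ p) ?P = f"
      by (auto simp: fun_eq_iff PiE_def extensional_def)
    show "(\<lambda>f. mat n n (\<lambda>(i, j). f (min i j, max i j))) ` (?P \<rightarrow>\<^sub>E UNIV) \<subseteq> sym_mats n"
      by (auto intro!: sym_matsI simp: min.commute max.commute)
    show "(\<lambda>S. restrict (\<lambda>p. S $$ p) ?P) ` sym_mats n \<subseteq> ?P \<rightarrow>\<^sub>E UNIV"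
      by (intro image_subsetI) simp
  qed
  then have "card (sym_mats n) = card (UNIV :: bit set) ^ card ?P"
    using fin by (simp add: bij_betw_same_card card_PiE)
  moreover have "(UNIV :: bit set) = {0, 1}" by (auto simp: bit_neq_0_iff)
  then have "card (UNIV :: bit set) = 2" by (metis card_2_iff zero_neq_one)
  ultimately show ?thesis by (simp only: card_pairs_le)
qed

section \<open>The code and its stopping sets\<close>

text \<open>Each line is an edge, so its check forces equal values at the two ends. The support of a
  codeword is thus closed under adjacency and, by connectedness, empty or everything.\<close>

lemma sym_code_eq:
  assumes "n \<ge> 1"
  shows "sym_code n = {\<lambda>S\<in>sym_mats n. 0, \<lambda>S\<in>sym_mats n. 1}"
proof -
  have ch: "(\<Sum>S\<in>sym_mats n. H_mat {A, B} S * c S) = c A + c B"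
    if AB: "A \<in> sym_mats n" "B \<in> sym_mats n" "adjacent n A B" for A B and c :: "bit mat \<Rightarrow> bit"
  proof -
    have "A \<noteq> B" using not_adjacent_self AB by blast
    have "(\<Sum>S\<in>sym_mats n. H_mat {A, B} S * c S) = (\<Sum>S\<in>{A, B}. c S)"
      using AB by (intro sum.mono_neutral_cong_right) (auto simp: H_mat_def finite_sym_mats)
    then show ?thesis using \<open>A \<noteq> B\<close> by simp
  qed
  have *: "c \<in> sym_code n \<longleftrightarrow> c \<in> sym_mats n \<rightarrow>\<^sub>E UNIV \<and>
    (\<forall>A B. A \<in> sym_mats n \<and> B \<in> sym_mats n \<and> adjacent n A B \<longrightarrow> c A + c B = 0)" for c
  proof -
    have "(\<forall>M\<in>sym_lines n. (\<Sum>S\<in>sym_mats n. H_mat M S * c S) = 0) \<longleftrightarrow>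
      (\<forall>A B. A \<in> sym_mats n \<and> B \<in> sym_mats n \<and> adjacent n A B \<longrightarrow>
        (\<Sum>S\<in>sym_mats n. H_mat {A, B} S * c S) = 0)"
      unfolding sym_lines_def mem_Collect_eq Ball_def is_line_iff[OF assms] by blast
    also have "\<dots> \<longleftrightarrow>
      (\<forall>A B. A \<in> sym_mats n \<and> B \<in> sym_mats n \<and> adjacent n A B \<longrightarrow> c A + c B = 0)"
      by (intro iff_allI imp_cong[OF refl], elim conjE) (simp only: ch)
    finally show ?thesis
      unfolding sym_code_def parity_check_code_def mem_Collect_eq by (rule arg_cong)
  qed
  have z: "x + y = 0 \<longleftrightarrow> x = y" for x y :: bit by (cases x; cases y) auto
  show ?thesis
  proof (intro equalityI subsetI)
    fix c assume "c \<in> sym_code n"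
    then have c: "c \<in> sym_mats n \<rightarrow>\<^sub>E UNIV"
      "\<And>A B. A \<in> sym_mats n \<Longrightarrow> B \<in> sym_mats n \<Longrightarrow> adjacent n A B \<Longrightarrow> c A = c B"
      unfolding * z by blast+
    let ?T = "{S \<in> sym_mats n. c S = 1}"
    show "c \<in> {\<lambda>S\<in>sym_mats n. 0, \<lambda>S\<in>sym_mats n. 1}"
    proof (cases "?T = {}")
      case True
      then have "c = (\<lambda>S\<in>sym_mats n. 0)"
        using c(1) by (auto simp: fun_eq_iff PiE_def extensional_def bit_neq_0_iff)
      then show ?thesis by simp
    next
      case False
      have "?T = sym_mats n"
        by (rule adjacent_closed_eq_sym_mats[OF _ False]) (use c(2) in auto)
      then have "c = (\<lambda>S\<in>sym_mats n. 1)"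
        using c(1) by (auto simp: fun_eq_iff PiE_def extensional_def)
      then show ?thesis by simp
    qed
  next
    fix c assume "c \<in> {\<lambda>S\<in>sym_mats n. 0, \<lambda>S\<in>sym_mats n. 1 :: bit}"
    then show "c \<in> sym_code n" unfolding * z by auto
  qed
qed

text \<open>A line meeting \<open>T\<close> in exactly one point is an edge with one end in
  \<open>T\<close>. Having no such edge means closure under adjacency.\<close>

lemma nonempty_stopping_set_iff:
  assumes "n \<ge> 1"
  shows "stopping_set (sym_lines n) (sym_mats n) H_mat T \<and> T \<noteq> {} \<longleftrightarrow> T = sym_mats n"
proof
  have H: "{p \<in> T. H_mat M p = 1} = T \<inter> M" for T M by (auto simp: H_mat_def)
  {
    assume "stopping_set (sym_lines n) (sym_mats n) H_mat T \<and> T \<noteq> {}"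
    then have T: "T \<subseteq> sym_mats n" "T \<noteq> {}" "\<And>M. is_line n M \<Longrightarrow> card (T \<inter> M) \<noteq> 1"
      by (auto simp: stopping_set_def H sym_lines_def)
    show "T = sym_mats n"
    proof (rule adjacent_closed_eq_sym_mats[OF T(1,2)])
      fix S U assume SU: "S \<in> T" "U \<in> sym_mats n" "adjacent n S U"
      show "U \<in> T"
      proof (rule ccontr)
        assume "U \<notin> T"
        then have "T \<inter> {S, U} = {S}" using SU(1) by blast
        moreover have "is_line n {S, U}" using is_line_iff[OF assms] SU T(1) by blast
        ultimately show False using T(3) by fastforce
      qed
    qed
  }
  {
    assume T: "T = sym_mats n"
    have "card (T \<inter> M) \<noteq> 1" if M: "M \<in> sym_lines n" for M
    proof -
      obtain S U where *: "M = {S, U}" "S \<in> T" "U \<in> T" "adjacent n S U"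
        using M is_line_iff[OF assms] T by (auto simp: sym_lines_def)
      then have "S \<noteq> U" using not_adjacent_self T by blast
      moreover have "T \<inter> M = {S, U}" using * by blast
      ultimately show ?thesis by simp
    qed
    moreover have "T \<noteq> {}" using outer_sym_mats T by blast
    ultimately show "stopping_set (sym_lines n) (sym_mats n) H_mat T \<and> T \<noteq> {}"
      using T by (auto simp: stopping_set_def H)
  }
qed

text \<open>Each infimum is over the singleton containing the number of points.\<close>

theorem theorem6:
  fixes n :: nat
  assumes "n \<ge> 1"
  shows "min_distance (sym_mats n) (sym_code n) = 2 ^ (n * (n + 1) div 2)
    \<and> stopping_distance (sym_lines n) (sym_mats n) H_mat = 2 ^ (n * (n + 1) div 2)"
proof
  let ?P = "sym_mats n"
  let ?zero = "\<lambda>S\<in>?P. 0 :: bit" and ?one = "\<lambda>S\<in>?P. 1 :: bit"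
  \<comment> \<open>The zero matrix serves as a point at which the two words differ.\<close>
  have ne: "?zero \<noteq> ?one"
    using outer_sym_mats[of n "\<lambda>_. 0"] by (metis restrict_apply' zero_neq_one)
  have "{p \<in> ?P. ?zero p \<noteq> ?one p} = ?P" "{p \<in> ?P. ?one p \<noteq> ?zero p} = ?P" by auto
  then have d: "hamming_dist ?P ?zero ?one = card ?P" "hamming_dist ?P ?one ?zero = card ?P"
    unfolding hamming_dist_def by simp_all
  have "{hamming_dist ?P c d | c d. c \<in> sym_code n \<and> d \<in> sym_code n \<and> c \<noteq> d} = {card ?P}"
    unfolding sym_code_eq[OF assms]
  proof (intro equalityI subsetI)
    fix k assume "k \<in> {hamming_dist ?P c d | c d. c \<in> {?zero, ?one} \<and> d \<in> {?zero, ?one} \<and> c \<noteq> d}"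
    then show "k \<in> {card ?P}" using d by auto
  next
    fix k assume "k \<in> {card ?P}"
    then have "k = hamming_dist ?P ?zero ?one" using d(1) by simp
    then show "k \<in> {hamming_dist ?P c d | c d. c \<in> {?zero, ?one} \<and> d \<in> {?zero, ?one} \<and> c \<noteq> d}"
      using ne by blast
  qed
  then show "min_distance ?P (sym_code n) = 2 ^ (n * (n + 1) div 2)"
    by (simp add: min_distance_def card_sym_mats)
  have "{card T | T. stopping_set (sym_lines n) ?P H_mat T \<and> T \<noteq> {}} = {card ?P}"
    unfolding nonempty_stopping_set_iff[OF assms] by simp
  then show "stopping_distance (sym_lines n) ?P H_mat = 2 ^ (n * (n + 1) div 2)"
    by (simp add: stopping_distance_def card_sym_mats)
qed

end
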